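(* The smallest alphabet on which there exists an infinite word $w$ such that both $w$ and its curling-number transform $C(w)$ are overlap-free has size $4$. That is, such an infinite word exists over an alphabet of size $4$, and no such infinite word exists over any alphabet of size less than $4$.
   Context: Words are indexed from $0$; infinite words are one-sided, $w = w[0]w[1]\cdots$; $x[i..j]$ denotes the factor (contiguous block) $x[i]\cdots x[j]$. An overlap is a word of the form $a x a x a$ with $a$ a single letter and $x$ a possibly empty word; a word is overlap-free if it contains no overlap as a factor. The curling number of a nonempty finite word $u$ is the largest integer $k \ge 1$ such that $u = y z^k$ for some (possibly empty) word $y$ and some nonempty word $z$. For a finite or infinite word $x$, the curling-number transform $C(x)$ is the word over the positive integers, of the same length as $x$, whose $i$-th letter $C(x)[i]$ is the curling number of the prefix $x[0..i]$. The alphabet size refers to the alphabet of $w$, not of $C(w)$. *)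

theory Defs
  imports Main "HOL-Library.Omega_Words_Fun"
begin

definition overlap :: "'a list \<Rightarrow> bool" where
  "overlap u \<longleftrightarrow> (\<exists>a x. u = [a] @ x @ [a] @ x @ [a])"

text \<open>The factors of an infinite word \<open>w\<close> are the lists \<open>w [i \<rightarrow> j]\<close>, whose right end \<open>j\<close> is exclusive.\<close>

definition overlap_free :: "'a word \<Rightarrow> bool" where
  "overlap_free w \<longleftrightarrow> \<not> (\<exists>i j. overlap (w [i \<rightarrow> j]))"

definition has_power_suffix :: "'a list \<Rightarrow> nat \<Rightarrow> bool" where
  "has_power_suffix u k \<longleftrightarrow> k \<ge> 1 \<and> (\<exists>y z. z \<noteq> [] \<and> u = y @ concat (replicate k z))"

text \<open>Only meaningful for nonempty words: \<open>[]\<close> has no such \<open>k\<close>.\<close>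

definition curling_number :: "'a list \<Rightarrow> nat" where
  "curling_number u = (GREATEST k. has_power_suffix u k)"

lemma has_power_suffix_le_length:
  assumes "has_power_suffix u k"
  shows "k \<le> length u"
proof -
  obtain y z where z: "z \<noteq> []" and u: "u = y @ concat (replicate k z)"
    using assms by (auto simp: has_power_suffix_def)
  have "length (concat (replicate k z)) = k * length z"
    by (simp add: length_concat sum_list_replicate)
  moreover have "k \<le> k * length z"
    using z by (cases z) simp_all
  ultimately show ?thesis using u by (simp add: trans_le_add2)
qed

lemma has_power_suffix_1:
  assumes "u \<noteq> []"
  shows "has_power_suffix u 1"
  using assms by (auto simp: has_power_suffix_def)

lemma curling_number_greatest:
  assumes "u \<noteq> []"
  shows "has_power_suffix u (curling_number u)"
    and "has_power_suffix u k \<Longrightarrow> k \<le> curling_number u"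
  unfolding curling_number_def
  using GreatestI_nat[of "has_power_suffix u" 1 "length u"]
    Greatest_le_nat[of "has_power_suffix u" k "length u"]
    has_power_suffix_1[OF assms] has_power_suffix_le_length by blast+

definition curling_transform :: "'a word \<Rightarrow> nat word" where
  "curling_transform w = (\<lambda>i. curling_number (w [0 \<rightarrow> Suc i]))"

end

theory Submission
  imports Defs
begin

text \<open>
  An overlap-free word contains no cube, so its curling numbers are 1 and 2, and the 2s mark the
  positions where a square ends.

  Four letters: replace the \<open>k\<close>-th letter of the Thue--Morse word by a block of length 16 that
  depends on four consecutive letters. The resulting word has only squares of period at most 5, and
  they end exactly where the Thue--Morse word, shifted by 27, carries a 1. Hence a square of period
  \<open>p \<ge> 34\<close> would yield a long run of period \<open>p\<close> in the Thue--Morse word; this forces \<open>16\<close> to divide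
  \<open>p\<close>, and after division by 16 the run, extended by one letter if necessary through a comparison of
  two blocks, is an overlap of the Thue--Morse word. Smaller periods are a finite check.

  Three letters: up to renaming, a good word has at position 0 or 1 the factor \<open>aab\<close> with curling
  numbers 1, 2, 1. Backtracking from there, guided by those binary words that can be continued
  without overlap as curling sequences, dies before length 84.
\<close>

section \<open>Periodic runs and curling numbers\<close>

text \<open>Says that the factor of length \<open>l + p\<close> starting at \<open>i\<close> has
  period \<open>p\<close>. Squares are the case \<open>l = p\<close>, overlaps the case
  \<open>l = Suc p\<close>.\<close>

definition periodic_run :: "'a word \<Rightarrow> nat \<Rightarrow> nat \<Rightarrow> nat \<Rightarrow> bool" where
  "periodic_run w p i l \<longleftrightarrow> (\<forall>k<l. w (i + k) = w (i + k + p))"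

lemma periodic_runD: "periodic_run w p i l \<Longrightarrow> i \<le> j \<Longrightarrow> j < i + l \<Longrightarrow> w j = w (j + p)"
  unfolding periodic_run_def by (metis le_add_diff_inverse nat_add_left_cancel_less)

lemma periodic_run_mono: "periodic_run w p i l \<Longrightarrow> i \<le> j \<Longrightarrow> j + m \<le> i + l \<Longrightarrow> periodic_run w p j m"
  by (auto simp: periodic_run_def[of w p j m] intro: periodic_runD)

lemma upt_split: "i \<le> j \<Longrightarrow> j \<le> k \<Longrightarrow> [i..<k] = [i..<j] @ [j..<k]"
  by (metis upt_add_eq_append le_add_diff_inverse)

lemma overlap_free_iff:
  "overlap_free w \<longleftrightarrow> (\<forall>p i. 0 < p \<longrightarrow> \<not> periodic_run w p i (Suc p))"
proof
  assume free: "overlap_free w"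
  show "\<forall>p i. 0 < p \<longrightarrow> \<not> periodic_run w p i (Suc p)"
  proof (intro allI impI notI)
    fix p i :: nat assume p: "0 < p" and run: "periodic_run w p i (Suc p)"
    define x where "x = w [Suc i \<rightarrow> i + p]"
    have shift: "w (i + k) = w (i + k + p)" if "k \<le> p" for k
      using run that by (simp add: periodic_run_def)
    have ends: "w (i + p) = w i" "w (i + 2 * p) = w i"
      using shift[of 0] shift[of p] by (simp_all add: mult_2 add.assoc)
    have x: "w [Suc (i + p) \<rightarrow> i + 2 * p] = x"
    proof (rule nth_equalityI)
      fix k assume "k < length (w [Suc (i + p) \<rightarrow> i + 2 * p])"
      then show "(w [Suc (i + p) \<rightarrow> i + 2 * p]) ! k = x ! k"
        using shift[of "Suc k"] by (simp add: x_def add_ac)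
    qed (simp add: x_def)
    have "[i..<Suc (i + 2 * p)] = [i] @ [Suc i..<i + p] @ [i + p] @ [Suc (i + p)..<i + 2 * p] @ [i + 2 * p]"
      using p upt_split[of i "i + p" "i + 2 * p"] by (simp add: upt_conv_Cons)
    then have "w [i \<rightarrow> Suc (i + 2 * p)] = [w i] @ x @ [w i] @ x @ [w i]"
      using ends x by (simp add: subsequence_def x_def)
    with free show False unfolding overlap_free_def overlap_def by blast
  qed
next
  assume none: "\<forall>p i. 0 < p \<longrightarrow> \<not> periodic_run w p i (Suc p)"
  show "overlap_free w"
    unfolding overlap_free_def overlap_def
  proof (intro notI, elim exE)
    fix i j a x assume eq: "w [i \<rightarrow> j] = [a] @ x @ [a] @ x @ [a]"
    define p where "p = Suc (length x)"
    have len: "j - i = 2 * p + 1" using arg_cong[OF eq, of length] by (simp add: p_def)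
    have nth: "w (i + k) = ((a # x) @ (a # x) @ [a]) ! k" if "k < 2 * p + 1" for k
      using arg_cong[OF eq, of "\<lambda>u. u ! k"] that len by simp
    have "w (i + k) = w (i + k + p)" if "k \<le> p" for k
    proof -
      have "w (i + k + p) = ((a # x) @ [a]) ! k"
        using nth[of "k + p"] that by (simp add: p_def add.assoc nth_append)
      moreover have "(a # x) @ (a # x) @ [a] = ((a # x) @ [a]) @ x @ [a]" by simp
      then have "w (i + k) = ((a # x) @ [a]) ! k"
        using nth[of k] that unfolding p_def by (metis nth_append length_append_singleton length_Cons
            less_Suc_eq_le mult_2 trans_le_add1 add.commute Suc_eq_plus1)
      ultimately show ?thesis by simp
    qed
    then have "periodic_run w p i (Suc p)" by (simp add: periodic_run_def)
    with none show False by (simp add: p_def)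
  qed
qed

lemma has_power_suffix_run:
  assumes "has_power_suffix (w [0 \<rightarrow> N]) k"
  obtains p where "0 < p" "k * p \<le> N" "periodic_run w p (N - k * p) ((k - 1) * p)"
proof -
  obtain y z where k: "k \<ge> 1" and z: "z \<noteq> []" and eq: "w [0 \<rightarrow> N] = y @ concat (replicate k z)"
    using assms by (auto simp: has_power_suffix_def)
  obtain l where l: "k = Suc l" using k by (cases k) auto
  define p r where "p = length z" and "r = concat (replicate l z)"
  \<comment> \<open>One copy of \<open>z\<close> can be split off at either end, leaving the same
    \<open>r\<close>. Comparing the two forms at distance \<open>p\<close> yields the
    period.\<close>
  have r: "concat (replicate k z) = z @ r" "concat (replicate k z) = r @ z"
    unfolding r_def l by (simp, induction l) auto
  have lr: "length r = l * p" by (simp add: r_def p_def length_concat sum_list_replicate)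
  have len: "N = length y + k * p"
    using arg_cong[OF eq, of length] lr unfolding r(1) by (simp add: l p_def)
  have nth: "w j = (y @ concat (replicate k z)) ! j" if "j < N" for j
    using arg_cong[OF eq, of "\<lambda>u. u ! j"] that by simp
  have "w (length y + j) = w (length y + j + p)" if "j < l * p" for j
  proof -
    have "w (length y + j) = r ! j"
      using nth[of "length y + j", unfolded r(2)] that len lr by (simp add: l nth_append)
    moreover have "w (length y + j + p) = r ! j"
      using nth[of "length y + j + p", unfolded r(1)] that len lr by (simp add: l nth_append p_def)
    ultimately show ?thesis by simp
  qed
  then have "periodic_run w p (N - k * p) ((k - 1) * p)" by (simp add: periodic_run_def len l)
  then show thesis using that[of p] z len by (simp add: p_def)
qed

lemma run_has_power_suffix:
  assumes "0 < p" "2 * p \<le> N" "periodic_run w p (N - 2 * p) p"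
  shows "has_power_suffix (w [0 \<rightarrow> N]) 2"
proof -
  define y z where "y = w [0 \<rightarrow> N - 2 * p]" and "z = w [N - 2 * p \<rightarrow> N - p]"
  have "w [N - p \<rightarrow> N] = z"
    using assms by (intro nth_equalityI) (auto simp: z_def periodic_run_def)
  moreover have "[0..<N] = [0..<N - 2 * p] @ [N - 2 * p..<N - p] @ [N - p..<N]"
    using assms(2) upt_split[of 0 "N - 2 * p" N] upt_split[of "N - 2 * p" "N - p" N]
    by simp
  ultimately have "w [0 \<rightarrow> N] = y @ z @ z"
    by (simp add: subsequence_def y_def z_def)
  moreover have "z \<noteq> []" using assms by (simp add: z_def)
  ultimately show ?thesis
    unfolding has_power_suffix_def by (auto simp: numeral_2_eq_2)
qed

section \<open>Squares and the curling numbers of overlap-free words\<close>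

definition square_ends :: "'a word \<Rightarrow> nat \<Rightarrow> nat \<Rightarrow> bool" where
  "square_ends w p n \<longleftrightarrow> 0 < p \<and> 2 * p \<le> Suc n \<and> periodic_run w p (Suc n - 2 * p) p"

lemma curling_transform_overlap_free:
  assumes "overlap_free w"
  shows "curling_transform w n = (if \<exists>p. square_ends w p n then 2 else 1)"
proof -
  let ?u = "w [0 \<rightarrow> Suc n]" and ?c = "curling_transform w n"
  have ne: "?u \<noteq> []" by simp
  have suf: "has_power_suffix ?u ?c"
    and max: "\<And>k. has_power_suffix ?u k \<Longrightarrow> k \<le> ?c"
    using curling_number_greatest[OF ne] by (simp_all add: curling_transform_def)
  obtain p where p: "0 < p" "?c * p \<le> Suc n" and run: "periodic_run w p (Suc n - ?c * p) ((?c - 1) * p)"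
    using has_power_suffix_run[OF suf] by blast
  have "?c \<ge> 1" using suf by (simp add: has_power_suffix_def)
  have "?c \<le> 2"
  proof (rule ccontr)
    assume "\<not> ?c \<le> 2"
    \<comment> \<open>A power with exponent at least 3 is a run of length at least
      \<open>2 * p \<ge> Suc p\<close>, so it contains an overlap.\<close>
    then have "2 * p \<le> (?c - 1) * p" by (intro mult_le_mono1) simp
    then have "periodic_run w p (Suc n - ?c * p) (Suc p)"
      using p(1) by (intro periodic_run_mono[OF run]) linarith+
    with assms p(1) show False by (auto simp: overlap_free_iff)
  qed
  moreover have "?c \<ge> 2" if "square_ends w q n" for q
    using that max[of 2] run_has_power_suffix[of q "Suc n" w] by (simp add: square_ends_def)
  moreover have "square_ends w p n" if "?c = 2"
    using p run that by (simp add: square_ends_def)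
  ultimately show ?thesis using \<open>?c \<ge> 1\<close> by (metis le_antisym not_less_eq_eq numeral_2_eq_2 One_nat_def)
qed

section \<open>The Thue--Morse word\<close>

text \<open>The parity of the number of ones in the binary expansion of \<open>n\<close>.\<close>

fun thue_morse :: "nat \<Rightarrow> bool" where
  "thue_morse n = (if n = 0 then False else thue_morse (n div 2) \<noteq> odd n)"

declare thue_morse.simps [simp del]

lemma thue_morse_double [simp]:
  "thue_morse (2 * n) = thue_morse n" "thue_morse (Suc (2 * n)) = (\<not> thue_morse n)"
  by (cases "n = 0", simp_all add: thue_morse.simps[of "2 * n"] thue_morse.simps[of "Suc (2 * n)"]
      thue_morse.simps[of 0])

lemma thue_morse_div2: "thue_morse n = (thue_morse (n div 2) \<noteq> odd n)"
  by (cases "n = 0") (simp_all add: thue_morse.simps[of n] thue_morse.simps[of 0])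

lemma thue_morse_even_shift:
  "thue_morse n = thue_morse (n + 2 * q) \<longleftrightarrow> thue_morse (n div 2) = thue_morse (n div 2 + q)"
  using thue_morse_div2[of n] thue_morse_div2[of "n + 2 * q"] by (auto simp: add.commute)

text \<open>Among three consecutive positions two form a pair \<open>2 * h\<close>,
  \<open>2 * h + 1\<close>, whose letters differ.\<close>

lemma thue_morse_no_cube: "\<not> (thue_morse n = thue_morse (n + 1) \<and> thue_morse n = thue_morse (n + 2))"
proof (cases "even n")
  case True
  then show ?thesis by (auto elim!: evenE)
next
  case False
  then have "even (Suc n)" by simp
  then obtain h where "Suc n = 2 * h" by (elim evenE)
  then have "thue_morse (n + 1) = thue_morse h" "thue_morse (n + 2) = (\<not> thue_morse h)"
    using thue_morse_double[of h] by simp_all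
  then show ?thesis by auto
qed

text \<open>After an even position the letter always changes. An odd shift exchanges even and odd
  positions, so both copies of the four letters must alternate. In the copy that starts at an odd
  position, this makes three consecutive letters at the halved indices equal.\<close>

lemma thue_morse_no_odd_run:
  assumes "odd p"
  shows "\<not> periodic_run thue_morse p m 4"
proof
  assume "periodic_run thue_morse p m 4"
  then have eq: "thue_morse (m + k) = thue_morse (m + p + k)" if "k < 4" for k
    using that by (simp add: periodic_run_def add_ac)
  have diff: "thue_morse (Suc j) = (\<not> thue_morse j)" if "even j" for j
    using that by (auto elim!: evenE)
  have alternating: False if "odd j" "\<And>k. k < 3 \<Longrightarrow> thue_morse (Suc (j + k)) = (\<not> thue_morse (j + k))" for j
  proof -
    from that(1) obtain h where "j = 2 * h + 1" by (rule oddE)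
    then have h: "j = Suc (2 * h)" by simp
    have "Suc (Suc (2 * h)) = 2 * (h + 1)" "Suc (Suc (Suc (Suc (2 * h)))) = 2 * (h + 2)" by simp_all
    then have "thue_morse (Suc j) = thue_morse (h + 1)" "thue_morse (Suc (Suc (Suc j))) = thue_morse (h + 2)"
      unfolding h by (simp_all only: thue_morse_double)
    moreover have "thue_morse j = (\<not> thue_morse h)" using h by simp
    moreover have "thue_morse (Suc j) = (\<not> thue_morse j)"
      "thue_morse (Suc (Suc (Suc j))) = (\<not> thue_morse j)"
      using that(2)[of 0] that(2)[of 1] that(2)[of 2] by (simp_all add: numeral_2_eq_2)
    ultimately show False using thue_morse_no_cube[of h] by auto
  qed
  have step: "thue_morse (Suc (m + k)) = (\<not> thue_morse (m + k))"
    "thue_morse (Suc (m + p + k)) = (\<not> thue_morse (m + p + k))" if "k < 3" for k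
  proof -
    have "thue_morse (m + k) = thue_morse (m + p + k)"
      "thue_morse (Suc (m + k)) = thue_morse (Suc (m + p + k))"
      using eq[of k] eq[of "Suc k"] that by simp_all
    moreover have "even (m + k) \<or> even (m + p + k)" using assms by auto
    ultimately show "thue_morse (Suc (m + k)) = (\<not> thue_morse (m + k))"
      "thue_morse (Suc (m + p + k)) = (\<not> thue_morse (m + p + k))"
      using diff by metis+
  qed
  show False
  proof (cases "odd m")
    case True
    then show False using alternating step(1) by blast
  next
    case False
    with assms have "odd (m + p)" by simp
    then show False using alternating step(2) by blast
  qed
qed

lemma thue_morse_halve_run:
  assumes "periodic_run thue_morse (2 * q) m (Suc (2 * l))"
  shows "periodic_run thue_morse q (m div 2) (Suc l)"
  unfolding periodic_run_def
proof (intro allI impI)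
  fix k assume "k < Suc l"
  then have "thue_morse (m + 2 * k) = thue_morse (m + 2 * k + 2 * q)"
    using assms by (simp add: periodic_run_def)
  moreover have "(m + 2 * k) div 2 = m div 2 + k" by simp
  ultimately show "thue_morse (m div 2 + k) = thue_morse (m div 2 + k + q)"
    using thue_morse_even_shift[of "m + 2 * k" q] by metis
qed

text \<open>Descent on the period: an even period is halved together with its run, an odd period
  from 3 on contradicts the bound on odd runs, and period 1 is a cube.\<close>

lemma overlap_free_thue_morse: "overlap_free thue_morse"
  unfolding overlap_free_iff
proof (intro allI impI)
  fix p i :: nat assume "0 < p"
  then show "\<not> periodic_run thue_morse p i (Suc p)"
  proof (induction p arbitrary: i rule: less_induct)
    case (less p)
    show ?case
    proof (cases "even p")
      case True
      then obtain q where "p = 2 * q" by (auto elim: evenE)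
      then show ?thesis using less.IH[of q] less.prems thue_morse_halve_run[of q i q] by auto
    next
      case False
      show ?thesis
      proof
        assume run: "periodic_run thue_morse p i (Suc p)"
        have "p \<noteq> 1"
        proof
          assume "p = 1"
          with run have "thue_morse (i + k) = thue_morse (i + k + 1)" if "k < 2" for k
            using that by (simp add: periodic_run_def)
          from this[of 0] this[of 1] show False using thue_morse_no_cube[of i] by simp
        qed
        with False have "3 \<le> p" by presburger
        then have "periodic_run thue_morse p i 4" by (intro periodic_run_mono[OF run]) auto
        with False thue_morse_no_odd_run show False by blast
      qed
    qed
  qed
qed

text \<open>Runs of length at least 4 have even period. Halving passes through the lengths 25, 13,
  7, 4, which gives four factors 2.\<close>

lemma thue_morse_long_run_dvd:
  assumes "periodic_run thue_morse p m 25"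
  shows "16 dvd p"
proof -
  have halve: "\<exists>q. p = 2 * q \<and> periodic_run thue_morse q (m div 2) (Suc l)"
    if "periodic_run thue_morse p m (Suc (2 * l))" "2 \<le> l" for p m l
  proof -
    have "periodic_run thue_morse p m 4" using that(2) by (intro periodic_run_mono[OF that(1)]) auto
    then have "even p" using thue_morse_no_odd_run by blast
    then obtain q where "p = 2 * q" by (auto elim: evenE)
    with that(1) show ?thesis using thue_morse_halve_run by blast
  qed
  obtain q1 where 1: "p = 2 * q1" "periodic_run thue_morse q1 (m div 2) 13"
    using halve[of p m 12] assms by auto
  obtain q2 where 2: "q1 = 2 * q2" "periodic_run thue_morse q2 (m div 2 div 2) 7"
    using halve[of q1 _ 6] 1 by auto
  obtain q3 where 3: "q2 = 2 * q3" "periodic_run thue_morse q3 (m div 2 div 2 div 2) 4"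
    using halve[of q2 _ 3] 2 by auto
  have "even q3" using 3 thue_morse_no_odd_run by blast
  with 1 2 3 show ?thesis by (auto elim!: evenE)
qed

lemma thue_morse_16_shift:
  "thue_morse n = thue_morse (n + 16 * q) \<longleftrightarrow> thue_morse (n div 16) = thue_morse (n div 16 + q)"
  using thue_morse_even_shift[of n "8 * q"] thue_morse_even_shift[of "n div 2" "4 * q"]
    thue_morse_even_shift[of "n div 2 div 2" "2 * q"] thue_morse_even_shift[of "n div 2 div 2 div 2" q]
  by (simp add: div_mult2_eq[symmetric])

section \<open>A word over four letters\<close>

text \<open>
  The blocks come from a computer search. Arguments that are not factors of the Thue--Morse word are
  irrelevant and share a block with some factor.
\<close>

definition block :: "bool \<Rightarrow> bool \<Rightarrow> bool \<Rightarrow> bool \<Rightarrow> nat list" where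
  "block a b c d =
    (if \<not> a then
       if \<not> b then [0,1,2,2,0,2,0,0,1,1,2,1,1,2,0,1]
       else if \<not> c \<and> \<not> d then [1,0,2,2,0,0,1,2,2,0,0,1,3,1,3,3]
       else [1,2,0,0,1,1,3,0,0,1,1,3,2,3,2,2]
     else
       if \<not> b then
         if \<not> c then [0,0,2,3,3,0,0,2,0,0,1,0,0,1,2,0]
         else if \<not> d then [1,1,3,0,0,1,1,3,1,1,0,1,1,0,2,1]
         else [1,1,0,2,2,1,1,0,1,1,2,1,1,2,0,1]
       else if \<not> c \<and> \<not> d then [0,0,3,0,0,3,1,0,0,3,1,1,3,1,3,3]
       else [0,0,1,0,0,1,2,0,0,1,2,2,0,2,0,0])"

definition curling_word :: "nat word" where
  "curling_word n = (let k = n div 16 in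
     block (thue_morse (k + 1)) (thue_morse (k + 2)) (thue_morse (k + 3)) (thue_morse (k + 4)) ! (n mod 16))"

lemma length_block [simp]: "length (block a b c d) = 16"
  by (simp add: block_def)

lemma curling_word_block:
  "r < 16 \<Longrightarrow> curling_word (16 * k + r) =
     block (thue_morse (k + 1)) (thue_morse (k + 2)) (thue_morse (k + 3)) (thue_morse (k + 4)) ! r"
  by (simp add: curling_word_def)

lemma range_curling_word: "range curling_word \<subseteq> {0, 1, 2, 3}"
proof -
  have "set (block a b c d) \<subseteq> {0, 1, 2, 3}" for a b c d
    by (simp add: block_def)
  moreover have "curling_word n \<in> set (block (thue_morse (n div 16 + 1)) (thue_morse (n div 16 + 2))
      (thue_morse (n div 16 + 3)) (thue_morse (n div 16 + 4)))" for n
    unfolding curling_word_def Let_def by (rule nth_mem) simp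
  ultimately show ?thesis by (intro image_subsetI) (rule subsetD)
qed

section \<open>Finite checks on windows of six blocks\<close>

fun blocks :: "bool list \<Rightarrow> nat list" where
  "blocks (a # b # c # d # bs) = block a b c d @ blocks (b # c # d # bs)"
| "blocks bs = []"

lemma blocks_thue_morse:
  "blocks (map thue_morse [Suc k..<k + m + 4]) = map curling_word [16 * k..<16 * (k + m)]"
proof (induction m arbitrary: k)
  case 0
  have "[Suc k..<k + 4] = [k + 1, k + 2, k + 3]"
    by (simp add: upt_rec numeral_eq_Suc)
  then show ?case by simp
next
  case (Suc m)
  have "[Suc k..<k + Suc m + 4] = (k + 1) # (k + 2) # (k + 3) # (k + 4) # [k + 5..<k + m + 5]"
    by (simp add: upt_conv_Cons numeral_eq_Suc)
  moreover have "[Suc (Suc k)..<Suc k + m + 4] = (k + 2) # (k + 3) # (k + 4) # [k + 5..<k + m + 5]"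
    by (simp add: upt_conv_Cons numeral_eq_Suc)
  moreover have "map curling_word [16 * k..<16 * k + 16] =
      block (thue_morse (k + 1)) (thue_morse (k + 2)) (thue_morse (k + 3)) (thue_morse (k + 4))"
    by (rule nth_equalityI) (simp_all add: curling_word_def)
  moreover have "[16 * k..<16 * (k + Suc m)] = [16 * k..<16 * k + 16] @ [16 * Suc k..<16 * (Suc k + m)]"
    using upt_split[of "16 * k" "16 * k + 16" "16 * (k + Suc m)"] by (simp add: algebra_simps)
  ultimately show ?case
    using Suc.IH[of "Suc k"] by simp
qed

fun morphism :: "bool list \<Rightarrow> bool list" where
  "morphism [] = []"
| "morphism (b # bs) = b # (\<not> b) # morphism bs"

lemma morphism_thue_morse: "morphism (map thue_morse [i..<j]) = map thue_morse [2 * i..<2 * j]"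
proof (induction "j - i" arbitrary: i)
  case (Suc m)
  then have "[i..<j] = i # [Suc i..<j]" and "[2 * i..<2 * j] = 2 * i # Suc (2 * i) # [2 * Suc i..<2 * j]"
    by (simp_all add: upt_conv_Cons)
  then show ?case using Suc.hyps(1)[of "Suc i"] Suc.hyps(2) by simp
qed simp

text \<open>A factor of length \<open>2 * m - 1\<close> lies in the image of a factor of length
  \<open>m\<close> under the Thue--Morse morphism. It misses the last letter of the image if it
  starts at an even position, and the first one otherwise.\<close>

definition refine :: "bool list list \<Rightarrow> bool list list" where
  "refine bss = concat (map (\<lambda>bs. [butlast (morphism bs), tl (morphism bs)]) bss)"

lemma refine_thue_morse:
  assumes "\<And>i. map thue_morse [i..<i + m] \<in> set bss" and "0 < m"
  shows "map thue_morse [i..<i + (2 * m - 1)] \<in> set (refine bss)"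
proof -
  define j where "j = i div 2"
  let ?u = "morphism (map thue_morse [j..<j + m])"
  have u: "?u = map thue_morse [2 * j..<2 * (j + m)]" by (rule morphism_thue_morse)
  have "[2 * j..<2 * (j + m)] = [2 * j..<2 * j + (2 * m - 1)] @ [2 * j + (2 * m - 1)]"
    using assms(2) upt_Suc_append[of "2 * j" "2 * j + (2 * m - 1)"] by (simp add: algebra_simps)
  then have "butlast ?u = map thue_morse [2 * j..<2 * j + (2 * m - 1)]"
    unfolding u by simp
  moreover have "[2 * j..<2 * (j + m)] = 2 * j # [Suc (2 * j)..<Suc (2 * j) + (2 * m - 1)]"
    using assms(2) by (subst upt_conv_Cons) auto
  then have "tl ?u = map thue_morse [Suc (2 * j)..<Suc (2 * j) + (2 * m - 1)]"
    unfolding u by simp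
  moreover have "i = 2 * j \<or> i = Suc (2 * j)" by (auto simp: j_def)
  ultimately have "map thue_morse [i..<i + (2 * m - 1)] \<in> {butlast ?u, tl ?u}" by (metis insert_iff)
  then show ?thesis using assms(1)[of j] by (fastforce simp: refine_def)
qed

text \<open>The lengths grow as 2, 3, 5, 9. Nine letters determine six consecutive blocks.\<close>

definition factors9 :: "bool list list" where
  "factors9 = refine (refine (refine [[a, b]. a \<leftarrow> [False, True], b \<leftarrow> [False, True]]))"

lemma factors9: "map thue_morse [i..<i + 9] \<in> set factors9"
proof -
  have 2: "map thue_morse [i..<i + 2] \<in> set [[a, b]. a \<leftarrow> [False, True], b \<leftarrow> [False, True]]" for i
    by (auto simp: upt_conv_Cons numeral_2_eq_2)
  have 3: "map thue_morse [i..<i + 3] \<in> set (refine [[a, b]. a \<leftarrow> [False, True], b \<leftarrow> [False, True]])" for i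
    using refine_thue_morse[OF 2] by simp
  have 5: "map thue_morse [i..<i + 5] \<in> set (refine (refine [[a, b]. a \<leftarrow> [False, True], b \<leftarrow> [False, True]]))" for i
    using refine_thue_morse[OF 3] by simp
  show ?thesis using refine_thue_morse[OF 5] by (simp add: factors9_def)
qed

text \<open>
  Here and below, functions that are run by \<open>code_simp\<close> branch by pattern matching: after each step of
  an \<open>if\<close> or \<open>case\<close> the simplifier would traverse the chosen branch, long lists included, once more.
\<close>

fun agree :: "nat \<Rightarrow> 'a list \<Rightarrow> 'a list \<Rightarrow> bool"
  and agree_if :: "bool \<Rightarrow> nat \<Rightarrow> 'a list \<Rightarrow> 'a list \<Rightarrow> bool" where
  "agree 0 xs ys = True"
| "agree (Suc k) (x # xs) (y # ys) = agree_if (x = y) k xs ys"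
| "agree (Suc k) [] ys = False"
| "agree (Suc k) (x # xs) [] = False"
| "agree_if True k xs ys = agree k xs ys"
| "agree_if False k xs ys = False"

lemma agree_iff: "agree k xs ys \<longleftrightarrow> k \<le> length xs \<and> k \<le> length ys \<and> (\<forall>i<k. xs ! i = ys ! i)"
  and "agree_if b k xs ys \<longleftrightarrow> b \<and> k \<le> length xs \<and> k \<le> length ys \<and> (\<forall>i<k. xs ! i = ys ! i)"
  by (induction k xs ys and b k xs ys rule: agree_agree_if.induct)
    (auto simp: nth_Cons' less_Suc_eq_0_disj)

lemma agree_map:
  assumes "i + p + l \<le> m"
  shows "agree l (drop i (map w [s..<s + m])) (drop (i + p) (map w [s..<s + m])) \<longleftrightarrow> periodic_run w p (s + i) l"
  using assms by (subst agree_iff) (auto simp: periodic_run_def add_ac)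

text \<open>With \<open>ys = drop p xs\<close> this tries \<open>f\<close> successive periods from
  \<open>p\<close> on, and the run length \<open>k\<close> grows along with the period. Starting
  with \<open>k = p\<close> excludes squares at the head of \<open>xs\<close>, starting with
  \<open>k = p + 1\<close> excludes overlaps.\<close>

fun no_runs :: "nat \<Rightarrow> nat \<Rightarrow> 'a list \<Rightarrow> 'a list \<Rightarrow> bool" where
  "no_runs 0 k xs ys = True"
| "no_runs (Suc f) k xs [] = False"
| "no_runs (Suc f) k xs (y # ys) = (\<not> agree k xs (y # ys) \<and> no_runs f (Suc k) xs ys)"

lemma no_runs_iff:
  "p + f \<le> length xs \<Longrightarrow> no_runs f k xs (drop p xs) \<longleftrightarrow> (\<forall>q<f. \<not> agree (k + q) xs (drop (p + q) xs))"
proof (induction f arbitrary: k p)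
  case (Suc f)
  then have "drop p xs = xs ! p # drop (Suc p) xs" by (simp add: Cons_nth_drop_Suc)
  then have "no_runs (Suc f) k xs (drop p xs) \<longleftrightarrow> \<not> agree k xs (drop p xs) \<and> no_runs f (Suc k) xs (drop (Suc p) xs)"
    by simp
  also have "\<dots> \<longleftrightarrow> (\<forall>q<Suc f. \<not> agree (k + q) xs (drop (p + q) xs))"
    using Suc.IH[of "Suc p" "Suc k"] Suc.prems by (auto simp: All_less_Suc2)
  finally show ?case .
qed simp

definition short_square_at_9 :: "'a list \<Rightarrow> bool" where
  "short_square_at_9 xs \<longleftrightarrow> agree 1 (drop 8 xs) (drop 9 xs) \<or> agree 2 (drop 6 xs) (drop 8 xs) \<or>
     agree 3 (drop 4 xs) (drop 7 xs) \<or> agree 4 (drop 2 xs) (drop 6 xs) \<or> agree 5 xs (drop 5 xs)"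

fun check_tails :: "bool list \<Rightarrow> nat list \<Rightarrow> bool" where
  "check_tails [] xs = True"
| "check_tails (e # es) xs \<longleftrightarrow> short_square_at_9 xs = e \<and> no_runs 5 2 xs (drop 1 xs) \<and>
     no_runs 28 6 xs (drop 6 xs) \<and> check_tails es (tl xs)"

text \<open>If \<open>bs\<close> starts at Thue--Morse index \<open>k + 1\<close>, its blocks start
  at position \<open>16 * k\<close>, and the images of \<open>bs ! 1\<close> and
  \<open>bs ! 2\<close> start at index \<open>16 * k + 32\<close>. Dropping 4 letters aligns start
  \<open>s\<close> with index \<open>s + 36\<close>, where 36 is the square end 9 plus the shift 27.
  Six blocks suffice: a start is at most 15, and period 33 needs 66 letters from there.\<close>

definition check_window :: "bool list \<Rightarrow> bool" where
  "check_window bs = check_tails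
     (take 16 (drop 4 (morphism (morphism (morphism (morphism [bs ! 1, bs ! 2])))))) (blocks bs)"

lemma check_factors9: "list_all check_window factors9"
  by code_simp

lemma check_tailsD:
  "check_tails es xs \<Longrightarrow> j < length es \<Longrightarrow> check_tails [es ! j] (drop j xs)"
proof (induction es arbitrary: j xs)
  case (Cons e es)
  then show ?case by (cases j) (simp_all add: drop_Suc)
qed simp

text \<open>Every start \<open>s\<close> falls into the first block of some window, and the check of
  that window covers all 16 such starts.\<close>

lemma
  shows squares_thue_morse: "(\<exists>p\<in>{1..<6}. periodic_run curling_word p (s + 10 - 2 * p) p) \<longleftrightarrow> thue_morse (s + 36)"
    and no_short_overlap: "p \<in> {1..<6} \<Longrightarrow> \<not> periodic_run curling_word p s (Suc p)"
    and no_medium_square: "p \<in> {6..<34} \<Longrightarrow> \<not> periodic_run curling_word p s p"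
proof -
  define k r where "k = s div 16" and "r = s mod 16"
  have s: "s = 16 * k + r" and r: "r < 16" by (simp_all add: k_def r_def)
  let ?bs = "map thue_morse [Suc k..<Suc k + 9]" and ?xs = "map curling_word [s..<s + (96 - r)]"
  have xs: "blocks ?bs = map curling_word [16 * k..<16 * k + 96]"
    using blocks_thue_morse[of k 6] by (simp add: algebra_simps)
  have "[?bs ! 1, ?bs ! 2] = map thue_morse [k + 2..<k + 4]"
    by (simp add: upt_conv_Cons numeral_eq_Suc)
  then have "morphism (morphism (morphism (morphism [?bs ! 1, ?bs ! 2]))) =
      map thue_morse [2 * (2 * (2 * (2 * (k + 2))))..<2 * (2 * (2 * (2 * (k + 4))))]"
    by (simp only: morphism_thue_morse)
  then have es: "take 16 (drop 4 (morphism (morphism (morphism (morphism [?bs ! 1, ?bs ! 2]))))) =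
      map thue_morse [16 * k + 36..<16 * k + 36 + 16]"
    by (simp only: drop_map take_map drop_upt) (simp add: algebra_simps)
  have "check_window ?bs" using check_factors9 factors9[of "Suc k"] by (simp add: list_all_iff)
  then have "check_tails [map thue_morse [16 * k + 36..<16 * k + 36 + 16] ! r] (drop r (map curling_word [16 * k..<16 * k + 96]))"
    unfolding check_window_def es xs using r by (intro check_tailsD) simp_all
  then have "check_tails [thue_morse (16 * k + 36 + r)] (map curling_word [16 * k + r..<16 * k + 96])"
    using r by (simp only: drop_map drop_upt) (simp del: upt_Suc check_tails.simps)
  then have chk: "short_square_at_9 ?xs = thue_morse (s + 36)"
    "no_runs 5 2 ?xs (drop 1 ?xs)" "no_runs 28 6 ?xs (drop 6 ?xs)"
    using r by (simp_all add: s add_ac)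
  have run: "agree l (drop i ?xs) (drop j ?xs) \<longleftrightarrow> periodic_run curling_word p (s + i) l"
    if "j = i + p" "j + l \<le> 96 - r" for i j p l
    using that agree_map by blast
  have run0: "agree l ?xs (drop p ?xs) \<longleftrightarrow> periodic_run curling_word p s l" if "p + l \<le> 96 - r" for p l
    using run[of p 0 p l] that by simp
  have "(\<exists>p\<in>{1..<6}. P p) \<longleftrightarrow> P 1 \<or> P 2 \<or> P 3 \<or> P 4 \<or> P (5 :: nat)" for P
    by (auto simp: atLeastLessThan_def numeral_eq_Suc less_Suc_eq Bex_def)
  moreover have "agree 1 (drop 8 ?xs) (drop 9 ?xs) = periodic_run curling_word 1 (s + 10 - 2 * 1) 1"
    "agree 2 (drop 6 ?xs) (drop 8 ?xs) = periodic_run curling_word 2 (s + 10 - 2 * 2) 2"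
    "agree 3 (drop 4 ?xs) (drop 7 ?xs) = periodic_run curling_word 3 (s + 10 - 2 * 3) 3"
    "agree 4 (drop 2 ?xs) (drop 6 ?xs) = periodic_run curling_word 4 (s + 10 - 2 * 4) 4"
    "agree 5 ?xs (drop 5 ?xs) = periodic_run curling_word 5 (s + 10 - 2 * 5) 5"
    using r run[of 9 8 1 1] run[of 8 6 2 2] run[of 7 4 3 3] run[of 6 2 4 4] run0[of 5 5]
    by (simp_all add: add.commute)
  ultimately show "(\<exists>p\<in>{1..<6}. periodic_run curling_word p (s + 10 - 2 * p) p) \<longleftrightarrow> thue_morse (s + 36)"
    using chk(1) unfolding short_square_at_9_def by presburger
  show "\<not> periodic_run curling_word p s (Suc p)" if p: "p \<in> {1..<6}"
  proof -
    have "\<forall>q<5. \<not> agree (2 + q) ?xs (drop (1 + q) ?xs)"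
      using chk(2) r by (subst (asm) no_runs_iff) auto
    moreover obtain q where q: "p = 1 + q" "q < 5" using p le_Suc_ex[of 1 p] by auto
    ultimately have "\<not> agree (2 + q) ?xs (drop (1 + q) ?xs)" by blast
    then show ?thesis using run0[of p "Suc p"] q r by simp
  qed
  show "\<not> periodic_run curling_word p s p" if p: "p \<in> {6..<34}"
  proof -
    have "\<forall>q<28. \<not> agree (6 + q) ?xs (drop (6 + q) ?xs)"
      using chk(3) r by (subst (asm) no_runs_iff) auto
    moreover obtain q where q: "p = 6 + q" "q < 28" using p le_Suc_ex[of 6 p] by auto
    ultimately have "\<not> agree (6 + q) ?xs (drop (6 + q) ?xs)" by blast
    then show ?thesis using run0[of p p] q r by simp
  qed
qed

section \<open>Exclusion of long squares\<close>

lemma block_first: "\<exists>r. 5 \<le> r \<and> r < 16 \<and> block False b c d ! r \<noteq> block True b c d ! r"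
  by (rule exI[of _ "if b \<and> (c \<or> d) then 6 else 5"]) (simp add: block_def)

lemma no_long_square:
  assumes p: "34 \<le> p"
  shows "\<not> periodic_run curling_word p i p"
proof
  assume run: "periodic_run curling_word p i p"
  have shift: "curling_word x = curling_word (x + p)" if "i \<le> x" "x < i + p" for x
    using periodic_runD[OF run that] .
  \<comment> \<open>\<open>thue_morse x\<close> is determined by the ten letters ending at position
    \<open>x - 27\<close>. The bounds keep these inside the first half of the square, which leaves
    \<open>p - 9\<close> values of \<open>x\<close>; this is at least 25 because
    \<open>34 \<le> p\<close>.\<close>
  have fine: "thue_morse x = thue_morse (x + p)" if x: "i + 36 \<le> x" "x < i + p + 27" for x
  proof -
    define j where "j = x - 36"
    have "periodic_run curling_word q (j + 10 - 2 * q) q = periodic_run curling_word q (j + p + 10 - 2 * q) q"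
      if q: "q \<in> {1..<6}" for q
    proof -
      have "curling_word (j + 10 - 2 * q + k) = curling_word (j + p + 10 - 2 * q + k)"
        "curling_word (j + 10 - 2 * q + k + q) = curling_word (j + p + 10 - 2 * q + k + q)" if "k < q" for k
        using shift[of "j + 10 - 2 * q + k"] shift[of "j + 10 - 2 * q + k + q"] x q that
        by (simp_all add: j_def algebra_simps)
      then show ?thesis by (auto simp: periodic_run_def)
    qed
    then have "thue_morse (j + 36) = thue_morse (j + p + 36)"
      unfolding squares_thue_morse[symmetric] by simp
    then show ?thesis using x by (simp add: j_def algebra_simps)
  qed
  then have "periodic_run thue_morse p (i + 36) 25" using p by (simp add: periodic_run_def)
  then have "16 dvd p" by (rule thue_morse_long_run_dvd)
  then obtain q where q: "p = 16 * q" by (rule dvdE)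
  define a \<rho> :: nat where "a = (i + 36) div 16" and "\<rho> = (i + 36) mod 16"
  have i: "i + 36 = 16 * a + \<rho>" unfolding a_def \<rho>_def by (rule mult_div_mod_eq[symmetric])
  have \<rho>: "\<rho> < 16" unfolding \<rho>_def by (rule mod_less_divisor) simp
  have coarse: "thue_morse (a + k) = thue_morse (a + k + q)"
    if x: "i + 36 \<le> x" "x < i + p + 27" "x div 16 = a + k" for x k
  proof -
    have "thue_morse x = thue_morse (x + 16 * q)" using fine[OF x(1,2)] unfolding q .
    then show ?thesis unfolding thue_morse_16_shift x(3) .
  qed
  \<comment> \<open>Sampling every 16th position gives a run of period \<open>q\<close> and length
    \<open>q\<close>, one letter short of an overlap.\<close>
  have run_a: "thue_morse (a + k) = thue_morse (a + k + q)" if "k < q" for k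
  proof (rule coarse)
    have "i + 36 + 16 * k = \<rho> + 16 * (a + k)" using i by (simp add: algebra_simps)
    moreover have "(\<rho> + 16 * (a + k)) div 16 = a + k + \<rho> div 16" by (rule div_mult_self2) simp
    ultimately show "(i + 36 + 16 * k) div 16 = a + k" using \<rho> by (simp only: div_less add_0_right)
    show "i + 36 \<le> i + 36 + 16 * k" "i + 36 + 16 * k < i + p + 27" using that q by linarith+
  qed
  show False
  proof (cases "\<rho> \<le> 9")
    case False
    \<comment> \<open>For \<open>\<rho> \<ge> 10\<close> the position \<open>16 * (a + q)\<close> is
      still in range and extends the run to the right.\<close>
    have "thue_morse (a + q) = thue_morse (a + q + q)"
    proof (rule coarse)
      show "(16 * (a + q)) div 16 = a + q" by simp
      show "i + 36 \<le> 16 * (a + q)" "16 * (a + q) < i + p + 27" using False q i p \<rho> by (simp_all add: algebra_simps)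
    qed
    then have "periodic_run thue_morse q a (Suc q)"
      using run_a by (auto simp: periodic_run_def less_Suc_eq)
    then show False using overlap_free_thue_morse q p by (auto simp: overlap_free_iff)
  next
    case True
    \<comment> \<open>Here the run is extended to the left, to index \<open>b + 1 = a - 1\<close>.
      Since \<open>i + 4 = 16 * b + \<rho>\<close> and \<open>\<rho> \<le> 9\<close>, the square
      contains all letters of block \<open>b\<close> from index 5 on, where
      \<open>block_first\<close> finds a difference.\<close>
    have "2 \<le> a" using i \<rho> by linarith
    then obtain b where b: "a = b + 2" by (metis le_add_diff_inverse2)
    have "thue_morse (b + 1) = thue_morse (b + q + 1)"
    proof (rule ccontr)
      assume ne: "thue_morse (b + 1) \<noteq> thue_morse (b + q + 1)"
      obtain r where r: "5 \<le> r" "r < 16"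
        and diff: "block False (thue_morse (b + 2)) (thue_morse (b + 3)) (thue_morse (b + 4)) ! r \<noteq>
          block True (thue_morse (b + 2)) (thue_morse (b + 3)) (thue_morse (b + 4)) ! r"
        using block_first by blast
      have "curling_word (16 * b + r) = curling_word (16 * b + r + p)"
        using i True r p by (intro shift) (simp_all add: b)
      moreover have "16 * b + r + p = 16 * (b + q) + r" by (simp add: q)
      ultimately have same: "curling_word (16 * b + r) = curling_word (16 * (b + q) + r)" by (simp only:)
      \<comment> \<open>\<open>34 \<le> p = 16 * q\<close> gives \<open>3 \<le> q\<close>, so the
        run covers the other three arguments of the two blocks.\<close>
      have "thue_morse (b + 2) = thue_morse (b + q + 2)" "thue_morse (b + 3) = thue_morse (b + q + 3)"
        "thue_morse (b + 4) = thue_morse (b + q + 4)"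
        using run_a[of 0] run_a[of 1] run_a[of 2] p q by (simp_all add: b eval_nat_numeral add_ac)
      then have "block (thue_morse (b + 1)) (thue_morse (b + 2)) (thue_morse (b + 3)) (thue_morse (b + 4)) ! r =
          block (thue_morse (b + q + 1)) (thue_morse (b + 2)) (thue_morse (b + 3)) (thue_morse (b + 4)) ! r"
        using same unfolding curling_word_block[OF r(2)] by (simp only:)
      with ne diff show False by (cases "thue_morse (b + 1)") auto
    qed
    then have "thue_morse (b + 1 + k) = thue_morse (b + 1 + k + q)" if "k < Suc q" for k
      using run_a[of "k - 1"] that by (cases k) (simp_all add: b add_ac)
    then have "periodic_run thue_morse q (b + 1) (Suc q)" by (simp add: periodic_run_def)
    then show False using overlap_free_thue_morse q p by (auto simp: overlap_free_iff)
  qed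
qed

lemma no_big_square: "6 \<le> p \<Longrightarrow> \<not> periodic_run curling_word p i p"
  using no_medium_square[of p i] no_long_square[of p i] by (cases "p < 34") auto

lemma overlap_free_curling_word: "overlap_free curling_word"
  unfolding overlap_free_iff
proof (intro allI impI)
  fix p i :: nat assume "0 < p"
  then show "\<not> periodic_run curling_word p i (Suc p)"
    using no_short_overlap[of p i] no_big_square[of p i] periodic_run_mono[of curling_word p i "Suc p" i p]
    by (cases "p < 6") auto
qed

section \<open>Curling numbers of the four-letter word\<close>

definition check_prefix :: "nat \<Rightarrow> bool" where
  "check_prefix n \<longleftrightarrow> no_runs n 1 (rev (map curling_word [0..<Suc n])) (drop 1 (rev (map curling_word [0..<Suc n]))) =
     (\<not> thue_morse (n + 27))"

text \<open>The window check sees squares only from end position 9 on; the earlier ends are treated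
  here. In the reversed prefix a square suffix becomes a square at the head.\<close>

lemma check_prefix: "list_all check_prefix [0, 1, 2, 3, 4, 5, 6, 7, 8]"
  by code_simp

lemma agree_rev_prefix:
  "0 < p \<Longrightarrow> agree p (rev (map w [0..<Suc n])) (drop p (rev (map w [0..<Suc n]))) \<longleftrightarrow> square_ends w p n"
proof -
  assume p: "0 < p"
  let ?u = "rev (map w [0..<Suc n])"
  have nth: "?u ! i = w (n - i)" if "i \<le> n" for i
    using that by (subst rev_nth) (simp_all del: upt_Suc)
  show ?thesis
  proof (cases "2 * p \<le> Suc n")
    case True
    have "agree p ?u (drop p ?u) \<longleftrightarrow> (\<forall>i<p. w (n - i) = w (n - (p + i)))"
      using True nth by (auto simp: agree_iff simp del: upt_Suc)
    also have "\<dots> \<longleftrightarrow> (\<forall>k<p. w (Suc n - 2 * p + k) = w (Suc n - 2 * p + k + p))"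
    proof (intro iffI allI impI)
      fix k assume *: "\<forall>i<p. w (n - i) = w (n - (p + i))" and "k < p"
      then have "w (n - (p - Suc k)) = w (n - (p + (p - Suc k)))" by (metis diff_less zero_less_Suc p)
      moreover have "n - (p - Suc k) = Suc n - 2 * p + k + p" "n - (p + (p - Suc k)) = Suc n - 2 * p + k"
        using True \<open>k < p\<close> by simp_all
      ultimately show "w (Suc n - 2 * p + k) = w (Suc n - 2 * p + k + p)" by (simp only:)
    next
      fix i assume *: "\<forall>k<p. w (Suc n - 2 * p + k) = w (Suc n - 2 * p + k + p)" and "i < p"
      then have "w (Suc n - 2 * p + (p - Suc i)) = w (Suc n - 2 * p + (p - Suc i) + p)"
        by (metis diff_less zero_less_Suc p)
      moreover have "Suc n - 2 * p + (p - Suc i) = n - (p + i)" "n - (p + i) + p = n - i"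
        using True \<open>i < p\<close> by simp_all
      ultimately show "w (n - i) = w (n - (p + i))" by (simp only:)
    qed
    finally show ?thesis using True p by (simp add: square_ends_def periodic_run_def)
  next
    case False
    then show ?thesis by (auto simp: agree_iff square_ends_def)
  qed
qed

lemma curling_word_square_ends: "(\<exists>p. square_ends curling_word p n) \<longleftrightarrow> thue_morse (n + 27)"
proof -
  have "square_ends curling_word p n \<Longrightarrow> p \<in> {1..<6}" for p
    using no_big_square[of p] by (cases "p < 6") (auto simp: square_ends_def)
  then have *: "(\<exists>p. square_ends curling_word p n) \<longleftrightarrow> (\<exists>p\<in>{1..<6}. square_ends curling_word p n)" by blast
  show ?thesis
  proof (cases "n < 9")
    case True
    let ?u = "rev (map curling_word [0..<Suc n])"
    have "check_prefix n" using True check_prefix by (auto simp: less_Suc_eq numeral_eq_Suc)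
    then have "(\<forall>q<n. \<not> agree (1 + q) ?u (drop (1 + q) ?u)) \<longleftrightarrow> \<not> thue_morse (n + 27)"
      unfolding check_prefix_def by (subst (asm) no_runs_iff) auto
    then have "(\<forall>q<n. \<not> square_ends curling_word (Suc q) n) \<longleftrightarrow> \<not> thue_morse (n + 27)"
      by (simp add: agree_rev_prefix del: upt_Suc)
    moreover have "square_ends curling_word p n \<Longrightarrow> p = Suc (p - 1) \<and> p - 1 < n" for p
      by (auto simp: square_ends_def)
    ultimately show ?thesis by metis
  next
    case False
    then have "square_ends curling_word p n \<longleftrightarrow> periodic_run curling_word p (n - 9 + 10 - 2 * p) p"
      if "p \<in> {1..<6}" for p
      using that by (auto simp: square_ends_def)
    then show ?thesis
      using squares_thue_morse[of "n - 9"] False unfolding * by (simp add: add.commute)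
  qed
qed

lemma overlap_free_curling_transform: "overlap_free (curling_transform curling_word)"
proof -
  have "curling_transform curling_word n = (if thue_morse (n + 27) then 2 else 1)" for n
    by (simp add: curling_transform_overlap_free[OF overlap_free_curling_word] curling_word_square_ends)
  then have "periodic_run (curling_transform curling_word) p i l \<Longrightarrow> periodic_run thue_morse p (i + 27) l" for p i l
    by (auto simp: periodic_run_def add_ac split: if_splits)
  then show ?thesis
    using overlap_free_thue_morse unfolding overlap_free_iff by blast
qed

section \<open>Words over three letters\<close>

datatype letter = A | B | C

text \<open>
  Let \<open>xs\<close> be a reversed word, \<open>ys = drop k xs\<close>, and append the letter \<open>xs ! (k - 1)\<close> to the word. Then
  \<open>compare k xs ys\<close> tells whether an overlap or a square of period \<open>k\<close> ends there. In the case \<open>Maybe\<close>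
  this is a square if the word is preceded by one suitable unknown letter; the search never meets
  this case and treats it as failure.
\<close>

datatype verdict = Free | Maybe | Square | Overlap

fun compare :: "nat \<Rightarrow> 'a list \<Rightarrow> 'a list \<Rightarrow> verdict"
  and resume :: "bool \<Rightarrow> nat \<Rightarrow> 'a list \<Rightarrow> 'a list \<Rightarrow> verdict" where
  "compare 0 xs ys = Overlap"
| "compare (Suc 0) xs [] = Square"
| "compare (Suc (Suc 0)) xs [] = Maybe"
| "compare (Suc (Suc (Suc k))) xs [] = Free"
| "compare (Suc k) [] (y # ys) = Free"
| "compare (Suc k) (x # xs) (y # ys) = resume (x = y) k xs ys"
| "resume True k xs ys = compare k xs ys"
| "resume False 0 xs ys = Square"
| "resume False (Suc k) xs ys = Free"

fun add_hit :: "'a \<Rightarrow> verdict \<Rightarrow> ('a \<times> verdict) list \<Rightarrow> ('a \<times> verdict) list" where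
  "add_hit y Free hs = hs"
| "add_hit y Maybe hs = (y, Maybe) # hs"
| "add_hit y Square hs = (y, Square) # hs"
| "add_hit y Overlap hs = (y, Overlap) # hs"

text \<open>
  The list \<open>qs\<close> only bounds the period: starting from the word itself it loses two elements per step,
  so that all \<open>p\<close> with \<open>2 * p \<le> length ws + 2\<close> are tried.
\<close>

fun hits :: "nat \<Rightarrow> 'a list \<Rightarrow> 'a list \<Rightarrow> 'b list \<Rightarrow> ('a \<times> verdict) list" where
  "hits p ws [] qs = []"
| "hits p ws (y # ys) [] = add_hit y (compare p ws ys) []"
| "hits p ws (y # ys) [q] = add_hit y (compare p ws ys) []"
| "hits p ws (y # ys) (q # q' # qs) = add_hit y (compare p ws ys) (hits (Suc p) ws ys qs)"

text \<open>The maximum in the order \<open>Free\<close>, \<open>Maybe\<close>,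
  \<open>Square\<close>, \<open>Overlap\<close>; the flag tells whether \<open>u\<close> counts. A
  letter may be hit by several periods, and the worst verdict decides.\<close>

fun worse :: "bool \<Rightarrow> verdict \<Rightarrow> verdict \<Rightarrow> verdict" where
  "worse False u v = v"
| "worse True Overlap v = Overlap"
| "worse True Free v = v"
| "worse True Square Overlap = Overlap"
| "worse True Square Square = Square"
| "worse True Square Maybe = Square"
| "worse True Square Free = Square"
| "worse True Maybe Overlap = Overlap"
| "worse True Maybe Square = Square"
| "worse True Maybe Maybe = Maybe"
| "worse True Maybe Free = Maybe"

fun status :: "'a \<Rightarrow> ('a \<times> verdict) list \<Rightarrow> verdict" where
  "status a [] = Free"
| "status a ((b, v) # hs) = worse (a = b) v (status a hs)"

text \<open>
  A trie describes the curling sequences that remain possible, with \<open>True\<close> for the curling number 2;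
  \<open>Nope\<close> stands for no sequence and \<open>Leaf\<close> for the end of the search depth.
\<close>

datatype trie = Nope | Leaf | Node trie trie

text \<open>Prunes binary words that cannot be continued without overlap to the full search
  depth.\<close>

fun node :: "trie \<Rightarrow> trie \<Rightarrow> trie" where
  "node Nope Nope = Nope"
| "node Nope Leaf = Node Nope Leaf"
| "node Nope (Node t u) = Node Nope (Node t u)"
| "node Leaf u = Node Leaf u"
| "node (Node s t) u = Node (Node s t) u"

primrec overlap_free_trie :: "nat \<Rightarrow> bool list \<Rightarrow> trie" where
  "overlap_free_trie 0 cs = Leaf"
| "overlap_free_trie (Suc m) cs =
    node (if status False (hits (Suc 0) cs cs cs) = Overlap then Nope else overlap_free_trie m (False # cs))
         (if status True (hits (Suc 0) cs cs cs) = Overlap then Nope else overlap_free_trie m (True # cs))"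

text \<open>The verdict on a new letter fixes its curling number, so the word and the path in the
  trie grow together; an overlap closes the branch.\<close>

primrec dead :: "trie \<Rightarrow> letter list \<Rightarrow> bool" where
  "dead Nope ws = True"
| "dead Leaf ws = False"
| "dead (Node s t) ws = (\<forall>a \<in> {A, B, C}. case status a (hits (Suc 0) ws ws ws) of
     Free \<Rightarrow> dead s (a # ws) | Maybe \<Rightarrow> False | Square \<Rightarrow> dead t (a # ws) | Overlap \<Rightarrow> True)"

text \<open>This and \<open>dead_steps\<close> recast the recursion for evaluation: the list of hits
  is computed once for all three letters, and verdicts are matched by equations.\<close>

definition dead_step :: "verdict \<Rightarrow> trie \<Rightarrow> trie \<Rightarrow> letter list \<Rightarrow> bool" where
  "dead_step v s t ws = (case v of
     Free \<Rightarrow> dead s ws | Maybe \<Rightarrow> False | Square \<Rightarrow> dead t ws | Overlap \<Rightarrow> True)"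

definition dead_steps :: "(letter \<times> verdict) list \<Rightarrow> trie \<Rightarrow> trie \<Rightarrow> letter list \<Rightarrow> bool" where
  "dead_steps hs s t ws \<longleftrightarrow> (\<forall>a \<in> {A, B, C}. dead_step (status a hs) s t (a # ws))"

lemma dead_step_code [code]:
  "dead_step Free s t ws = dead s ws"
  "dead_step Maybe s t ws = False"
  "dead_step Square s t ws = dead t ws"
  "dead_step Overlap s t ws = True"
  by (simp_all add: dead_step_def)

lemma dead_steps_code [code]:
  "dead_steps hs s t ws \<longleftrightarrow> dead_step (status A hs) s t (A # ws) \<and>
     dead_step (status B hs) s t (B # ws) \<and> dead_step (status C hs) s t (C # ws)"
  by (simp add: dead_steps_def)

lemma dead_code [code]:
  "dead Nope ws = True"
  "dead Leaf ws = False"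
  "dead (Node s t) ws = dead_steps (hits (Suc 0) ws ws ws) s t ws"
  by (simp_all only: dead.simps dead_steps_def dead_step_def)

text \<open>The arguments are the reversed curling numbers 1, 2, 1 and the reversed word
  \<open>aab\<close>. The trie adds 81 letters to these 3, and no branch reaches a leaf or the
  verdict \<open>Maybe\<close>.\<close>

lemma dead_root: "dead (overlap_free_trie 81 [False, True, False]) [B, A, A]"
  by code_simp

section \<open>Correctness of the search\<close>

lemma compare_Overlap:
  "compare k xs ys = Overlap \<Longrightarrow> k \<le> length ys \<and> (\<forall>i<k. xs ! i = ys ! i)"
  and "resume b k xs ys = Overlap \<Longrightarrow> b \<and> k \<le> length ys \<and> (\<forall>i<k. xs ! i = ys ! i)"
  by (induction k xs ys and b k xs ys rule: compare_resume.induct)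
    (auto simp: nth_Cons' less_Suc_eq_0_disj)

lemma compare_Square:
  "compare k xs ys = Square \<Longrightarrow> 0 < k \<and> k \<le> Suc (length ys) \<and> (\<forall>i. Suc i < k \<longrightarrow> xs ! i = ys ! i)"
  and "resume b k xs ys = Square \<Longrightarrow> if b
    then 0 < k \<and> k \<le> Suc (length ys) \<and> (\<forall>i. Suc i < k \<longrightarrow> xs ! i = ys ! i) else k = 0"
  by (induction k xs ys and b k xs ys rule: compare_resume.induct)
    (auto simp: nth_Cons' less_Suc_eq_0_disj split: if_splits)

text \<open>A square of period \<open>k\<close> needs \<open>k - 1\<close> comparisons, of which at
  most one lies beyond \<open>ys\<close> under the bound. \<open>Free\<close> thus shows a mismatch
  among known letters and excludes the square even with an unknown letter in front.\<close>

lemma compare_Free: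
  "compare k xs ys = Free \<Longrightarrow> length ys \<le> length xs \<Longrightarrow> k \<le> length ys + 2 \<Longrightarrow>
     \<exists>i<length ys. Suc i < k \<and> xs ! i \<noteq> ys ! i"
  and "resume b k xs ys = Free \<Longrightarrow> length ys \<le> length xs \<Longrightarrow> k \<le> length ys + 2 \<Longrightarrow>
     if b then \<exists>i<length ys. Suc i < k \<and> xs ! i \<noteq> ys ! i else 0 < k"
  by (induction k xs ys and b k xs ys rule: compare_resume.induct)
    (auto simp: Suc_le_eq intro: exI[of _ 0] exI[of _ "Suc _"] split: if_splits)

lemma set_add_hit: "set (add_hit y v hs) = (if v = Free then {} else {(y, v)}) \<union> set hs"
  by (cases v) auto

lemma in_set_hits_iff:
  "(a, v) \<in> set (hits p ws ys qs) \<longleftrightarrow> v \<noteq> Free \<and>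
     (\<exists>q<length ys. 2 * q \<le> length qs \<and> a = ys ! q \<and> v = compare (p + q) ws (drop (Suc q) ys))"
  by (induction p ws ys qs rule: hits.induct) (auto simp: set_add_hit Ex_less_Suc2)

lemma worse_Free_iff: "worse b u v = Free \<longleftrightarrow> (b \<longrightarrow> u = Free) \<and> v = Free"
  by (cases "(b, u, v)" rule: worse.cases) auto

lemma worse_cases: "worse b u v = Free \<or> b \<and> worse b u v = u \<or> v \<noteq> Free \<and> worse b u v = v"
  by (cases "(b, u, v)" rule: worse.cases) auto

lemma status_Free_iff: "status a hs = Free \<longleftrightarrow> (\<forall>v. (a, v) \<in> set hs \<longrightarrow> v = Free)"
  by (induction a hs rule: status.induct) (auto simp: worse_Free_iff)

lemma status_in_set: "status a hs \<noteq> Free \<Longrightarrow> (a, status a hs) \<in> set hs"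
proof (induction a hs rule: status.induct)
  case (2 a b v hs)
  then show ?case using worse_cases[of "a = b" v "status a hs"] by (auto simp: worse_Free_iff)
qed simp

lemma rev_map_upt_nth: "i < n \<Longrightarrow> rev (map f [0..<n]) ! i = f (n - Suc i)"
  by (simp add: rev_nth)

lemma match_run:
  assumes "0 < p" "p + m \<le> n" "f n = f (n - p)"
    and "\<And>i. i < m \<Longrightarrow> rev (map f [0..<n]) ! i = rev (map f [0..<n]) ! (p + i)"
  shows "periodic_run f p (n - p - m) (Suc m)"
  unfolding periodic_run_def
proof (intro allI impI)
  fix k assume "k < Suc m"
  show "f (n - p - m + k) = f (n - p - m + k + p)"
  proof (cases "k = m")
    case False
    with \<open>k < Suc m\<close> have "m - Suc k < m" by simp
    from assms(4)[OF this] have "f (n - Suc (m - Suc k)) = f (n - Suc (p + (m - Suc k)))"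
      using assms(2) \<open>k < Suc m\<close> False by (simp add: rev_map_upt_nth)
    moreover have "n - Suc (m - Suc k) = n - p - m + k + p" "n - Suc (p + (m - Suc k)) = n - p - m + k"
      using assms(2) \<open>k < Suc m\<close> False by simp_all
    ultimately show ?thesis by (simp only:)
  qed (use assms in simp)
qed

lemma hits_run:
  assumes "(f n, v) \<in> set (hits (Suc 0) (rev (map f [0..<n])) (rev (map f [0..<n])) qs)"
  obtains p where "0 < p" "v = Overlap \<Longrightarrow> periodic_run f p (n - 2 * p) (Suc p)"
    "v = Square \<Longrightarrow> square_ends f p n"
proof -
  let ?ws = "rev (map f [0..<n])"
  obtain q where q: "q < n" "f n = ?ws ! q" and v: "v = compare (Suc q) ?ws (drop (Suc q) ?ws)"
    using assms by (auto simp: in_set_hits_iff)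
  have fn: "f n = f (n - Suc q)" using q by (simp add: rev_map_upt_nth)
  have "periodic_run f (Suc q) (n - 2 * Suc q) (Suc (Suc q))" if "v = Overlap"
  proof -
    have m: "Suc q \<le> n - Suc q" "\<And>i. i < Suc q \<Longrightarrow> ?ws ! i = drop (Suc q) ?ws ! i"
      using compare_Overlap(1)[of "Suc q" ?ws "drop (Suc q) ?ws"] that v by auto
    then have "periodic_run f (Suc q) (n - Suc q - Suc q) (Suc (Suc q))"
      using fn by (intro match_run) auto
    then show ?thesis by (simp add: mult_2 diff_diff_left)
  qed
  moreover have "square_ends f (Suc q) n" if "v = Square"
  proof -
    have m: "Suc q \<le> Suc (n - Suc q)" "\<And>i. i < q \<Longrightarrow> ?ws ! i = drop (Suc q) ?ws ! i"
      using compare_Square(1)[of "Suc q" ?ws "drop (Suc q) ?ws"] that v by auto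
    then have "periodic_run f (Suc q) (n - Suc q - q) (Suc q)"
      using fn q(1) by (intro match_run) auto
    moreover have "n - Suc q - q = Suc n - 2 * Suc q" by simp
    ultimately show ?thesis using m(1) q(1) by (simp add: square_ends_def)
  qed
  ultimately show thesis using that[of "Suc q"] by simp
qed

fun accepts :: "trie \<Rightarrow> bool word \<Rightarrow> bool" where
  "accepts Nope f = False"
| "accepts Leaf f = True"
| "accepts (Node s t) f = accepts (if f 0 then t else s) (\<lambda>k. f (Suc k))"

lemma accepts_node: "accepts (node s t) f = accepts (if f 0 then t else s) (\<lambda>k. f (Suc k))"
  by (cases "(s, t)" rule: node.cases) auto

text \<open>The next value of \<open>c\<close> never receives the verdict \<open>Overlap\<close>, so
  the path of \<open>c\<close> is never cut off.\<close>

lemma accepts_overlap_free_trie: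
  assumes "overlap_free c"
  shows "accepts (overlap_free_trie m (rev (map c [0..<n]))) (\<lambda>k. c (n + k))"
proof (induction m arbitrary: n)
  case (Suc m)
  let ?cs = "rev (map c [0..<n])"
  have "status (c n) (hits (Suc 0) ?cs ?cs ?cs) \<noteq> Overlap"
  proof
    assume "status (c n) (hits (Suc 0) ?cs ?cs ?cs) = Overlap"
    then have "(c n, Overlap) \<in> set (hits (Suc 0) ?cs ?cs ?cs)"
      using status_in_set[of "c n" "hits (Suc 0) ?cs ?cs ?cs"] by simp
    then obtain p where "0 < p" "periodic_run c p (n - 2 * p) (Suc p)" by (rule hits_run) simp
    then show False using assms unfolding overlap_free_iff by blast
  qed
  then show ?case using Suc.IH[of "Suc n"] by (cases "c n") (auto simp: accepts_node)
qed simp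

text \<open>
  The word \<open>v\<close> may be a longer word without its first letter, hence the bound \<open>2 * p \<le> n + 2\<close> for the
  squares behind \<open>c\<close>.
\<close>

lemma dead_imp_False:
  assumes free: "overlap_free v"
    and square: "\<And>n p. square_ends v p n \<Longrightarrow> c n"
    and converse: "\<And>n. c n \<Longrightarrow> \<exists>p>0. 2 * p \<le> n + 2 \<and> (\<forall>j. j + p \<le> n \<longrightarrow> n < j + 2 * p \<longrightarrow> v j = v (j + p))"
  shows "dead t (rev (map v [0..<n])) \<Longrightarrow> accepts t (\<lambda>k. c (n + k)) \<Longrightarrow> 2 \<le> n \<Longrightarrow> False"
proof (induction t arbitrary: n)
  case (Node s t)
  let ?ws = "rev (map v [0..<n])"
  let ?hs = "hits (Suc 0) ?ws ?ws ?ws"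
  have "v n \<in> {A, B, C}" by (cases "v n") auto
  then have dead: "case status (v n) ?hs of Free \<Rightarrow> dead s (v n # ?ws) | Maybe \<Rightarrow> False
      | Square \<Rightarrow> dead t (v n # ?ws) | Overlap \<Rightarrow> True"
    using Node.prems(1) unfolding dead.simps by blast
  have hit: "(v n, status (v n) ?hs) \<in> set ?hs" if "status (v n) ?hs \<noteq> Free"
    using that by (rule status_in_set)
  show False
  proof (cases "status (v n) ?hs")
    case Free
    \<comment> \<open>A square behind \<open>c n\<close> would make the comparison for its period
      free of mismatches. Hence the path continues in the subtrie for curling number 1.\<close>
    have "\<not> c n"
    proof
      assume "c n"
      then obtain p where p: "0 < p" "2 * p \<le> n + 2"
        and eq: "\<And>j. j + p \<le> n \<Longrightarrow> n < j + 2 * p \<Longrightarrow> v j = v (j + p)"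
        using converse by blast
      obtain q where q: "p = Suc q" using p(1) by (cases p) auto
      \<comment> \<open>\<open>2 * p \<le> n + 2\<close> and \<open>2 \<le> n\<close> give
        \<open>p \<le> n\<close>, so position \<open>n - p\<close> lies inside the word.\<close>
      have "v n = ?ws ! q" using eq[of "n - p"] p Node.prems(3) q by (simp add: rev_map_upt_nth)
      then have "compare p ?ws (drop p ?ws) = Free"
        using Free p q Node.prems(3) unfolding status_Free_iff in_set_hits_iff by auto
      then have "\<exists>i<n - p. Suc i < p \<and> ?ws ! i \<noteq> drop p ?ws ! i"
        using compare_Free(1)[of p ?ws "drop p ?ws"] p by simp
      then obtain i where i: "i < n - p" "Suc i < p" "?ws ! i \<noteq> ?ws ! (p + i)" by auto
      have "v (n - Suc (p + i)) = v (n - Suc (p + i) + p)" using i(1,2) by (intro eq) simp_all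
      moreover have "n - Suc (p + i) + p = n - Suc i" using i(1) by simp
      ultimately show False using i by (simp add: rev_map_upt_nth)
    qed
    then show False using Node.IH(1)[of "Suc n"] Node.prems dead Free by simp
  next
    case Maybe
    with dead show False by simp
  next
    case Square
    with hit have "(v n, Square) \<in> set ?hs" by simp
    then obtain p where "square_ends v p n" by (rule hits_run) simp
    then have "c n" by (rule square)
    then show False using Node.IH(2)[of "Suc n"] Node.prems dead Square by simp
  next
    case Overlap
    with hit have "(v n, Overlap) \<in> set ?hs" by simp
    then obtain p where "0 < p" "periodic_run v p (n - 2 * p) (Suc p)" by (rule hits_run) simp
    then show False using free unfolding overlap_free_iff by blast
  qed
qed simp_all

section \<open>Reduction of an arbitrary word to the search\<close>

lemma no_ternary_word:
  fixes w :: "'a word"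
  assumes "finite S" "card S < 4" "range w \<subseteq> S"
    and free: "overlap_free w" and free_curling: "overlap_free (curling_transform w)"
  shows False
proof -
  let ?c = "curling_transform w"
  note curling = curling_transform_overlap_free[OF free]
  have square1: "square_ends w 1 n \<longleftrightarrow> (\<exists>m. n = Suc m \<and> w m = w n)" for n
    by (cases n) (auto simp: square_ends_def periodic_run_def)
  have no_cube: "\<not> (w n = w (n + 1) \<and> w (n + 1) = w (n + 2))" for n
    using free[unfolded overlap_free_iff, rule_format, of 1 n]
    by (auto simp: periodic_run_def less_Suc_eq numeral_2_eq_2)
  have no_ones: "\<not> (?c n = 1 \<and> ?c (n + 1) = 1 \<and> ?c (n + 2) = 1)" for n
    using free_curling[unfolded overlap_free_iff, rule_format, of 1 n]
    by (auto simp: periodic_run_def less_Suc_eq numeral_2_eq_2)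
  have short: "p = 1" if "square_ends w p n" "n \<le> 2" for p n
    using that by (auto simp: square_ends_def)
  \<comment> \<open>If the first two letters differ, the first two curling numbers are 1. The
    transform contains no cube, so a square ends at position 2, and only period 1 fits
    there.\<close>
  obtain i where i: "i \<le> 1" "w i = w (i + 1)" "w (i + 2) \<noteq> w i" "i = 1 \<Longrightarrow> w 0 \<noteq> w 1"
  proof (cases "w 0 = w 1")
    case True
    then show thesis using that[of 0] no_cube[of 0] by auto
  next
    case False
    have "\<not> square_ends w p 0" for p by (simp add: square_ends_def)
    moreover have "\<not> square_ends w p 1" for p
      using short[of p 1] square1[of 1] False by auto
    ultimately have "?c 0 = 1" "?c 1 = 1" by (simp_all add: curling)
    then have "?c 2 \<noteq> 1" using no_ones[of 0] by (simp add: numeral_2_eq_2)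
    then obtain p where "square_ends w p 2" unfolding curling by presburger
    then have "w 1 = w 2" using short[of p 2] square1[of 2] by (auto simp: numeral_2_eq_2)
    then show thesis using that[of 1] no_cube[of 1] False by (auto simp: numeral_eq_Suc)
  qed
  define c where "c n \<longleftrightarrow> (\<exists>p. square_ends w p (i + n))" for n
  define f where "f x = (if x = w i then A else if x = w (i + 2) then B else C)" for x
  define v where "v n = f (w (i + n))" for n
  \<comment> \<open>Only \<open>C\<close> can have two preimages in \<open>S\<close>, and these
    together with \<open>w i\<close> and \<open>w (i + 2)\<close> would be four elements.\<close>
  have f_inj: "x = y" if "x \<in> S" "y \<in> S" "f x = f y" for x y
  proof (rule ccontr)
    assume "x \<noteq> y"
    then have "{w i, w (i + 2), x, y} \<subseteq> S" "card {w i, w (i + 2), x, y} = 4"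
      using that assms(3) i(3) by (auto simp: f_def split: if_splits)
    then show False using card_mono[OF assms(1), of "{w i, w (i + 2), x, y}"] assms(2) by simp
  qed
  have v_eq: "v m = v n \<longleftrightarrow> w (i + m) = w (i + n)" for m n
    unfolding v_def using f_inj[of "w (i + m)" "w (i + n)"] assms(3) by auto
  have v_run: "periodic_run v p n l \<longleftrightarrow> periodic_run w p (i + n) l" for p n l
    by (simp add: periodic_run_def v_eq add.assoc)
  have "overlap_free c"
  proof -
    have "periodic_run c p n l \<Longrightarrow> periodic_run ?c p (i + n) l" for p n l
      by (auto simp: periodic_run_def c_def curling add.assoc)
    then show ?thesis using free_curling unfolding overlap_free_iff by blast
  qed
  moreover have "rev (map c [0..<3]) = [False, True, False]"
  proof -
    have "\<not> c 0" using i short[of _ i] square1[of i] by (auto simp: c_def)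
    moreover have "c 1" using i square1[of "i + 1"] unfolding c_def by auto
    moreover have "\<not> c 2"
    proof
      assume "c 2"
      then obtain p where p: "square_ends w p (i + 2)" by (auto simp: c_def)
      \<comment> \<open>A square of period 2 would reach back to position 0, and
        \<open>w 0 \<noteq> w 1\<close> excludes it.\<close>
      then have "p = 1 \<or> p = 2 \<and> i = 1" using i(1) by (auto simp: square_ends_def)
      then show False
      proof
        assume "p = 1"
        with p have "w (i + 1) = w (i + 2)" using square1[of "i + 2"] by auto
        with i show False by simp
      next
        assume "p = 2 \<and> i = 1"
        with p have "w 0 = w 2" by (auto simp: square_ends_def periodic_run_def numeral_2_eq_2)
        with i \<open>p = 2 \<and> i = 1\<close> show False by (simp add: numeral_2_eq_2)
      qed
    qed
    ultimately show ?thesis by (simp add: numeral_3_eq_3 numeral_2_eq_2)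
  qed
  ultimately have "accepts (overlap_free_trie 81 [False, True, False]) (\<lambda>k. c (3 + k))"
    using accepts_overlap_free_trie[of c 81 3] by simp
  moreover have "rev (map v [0..<3]) = [B, A, A]"
    using i by (simp add: numeral_3_eq_3 v_def f_def)
  then have "dead (overlap_free_trie 81 [False, True, False]) (rev (map v [0..<3]))"
    using dead_root by simp
  moreover have "overlap_free v" using free unfolding overlap_free_iff v_run by blast
  moreover have "c n" if "square_ends v p n" for n p
  proof -
    have start: "Suc (i + n) - 2 * p = i + (Suc n - 2 * p)" using that by (auto simp: square_ends_def)
    have "periodic_run v p (Suc n - 2 * p) p" using that by (simp only: square_ends_def)
    then have "periodic_run w p (Suc (i + n) - 2 * p) p" by (simp only: v_run start)
    then have "square_ends w p (i + n)" using that by (simp add: square_ends_def)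
    then show ?thesis by (auto simp: c_def)
  qed
  \<comment> \<open>For \<open>i = 1\<close> the square may begin with \<open>w 0\<close>, the
    letter in front of \<open>v\<close>; the bound \<open>Suc (i + n)\<close> becomes
    \<open>n + 2\<close>.\<close>
  moreover have "\<exists>p>0. 2 * p \<le> n + 2 \<and> (\<forall>j. j + p \<le> n \<longrightarrow> n < j + 2 * p \<longrightarrow> v j = v (j + p))" if "c n" for n
  proof -
    from that obtain p where "square_ends w p (i + n)" unfolding c_def by (rule exE)
    then have p: "0 < p" "2 * p \<le> Suc (i + n)" and run: "periodic_run w p (Suc (i + n) - 2 * p) p"
      by (simp_all only: square_ends_def)
    have "v j = v (j + p)" if "j + p \<le> n" "n < j + 2 * p" for j
      using periodic_runD[OF run, of "i + j"] that p by (simp add: v_eq add.assoc)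
    with p i(1) show ?thesis by (intro exI[of _ p]) simp
  qed
  ultimately show False using dead_imp_False[of v c _ 3] by simp
qed

theorem corollary13:
  shows "(\<exists>(A :: nat set) (w :: nat word).
            finite A \<and> card A = 4 \<and> range w \<subseteq> A \<and>
            overlap_free w \<and> overlap_free (curling_transform w))
       \<and> (\<forall>B :: 'a set. finite B \<and> card B < 4 \<longrightarrow>
            \<not> (\<exists>w :: 'a word. range w \<subseteq> B \<and>
                  overlap_free w \<and> overlap_free (curling_transform w)))"
proof
  show "\<exists>(A :: nat set) (w :: nat word). finite A \<and> card A = 4 \<and> range w \<subseteq> A \<and>
      overlap_free w \<and> overlap_free (curling_transform w)"
    using range_curling_word overlap_free_curling_word overlap_free_curling_transform
    by (intro exI[of _ "{0, 1, 2, 3}"] exI[of _ curling_word]) simp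
  show "\<forall>B :: 'a set. finite B \<and> card B < 4 \<longrightarrow>
      \<not> (\<exists>w :: 'a word. range w \<subseteq> B \<and> overlap_free w \<and> overlap_free (curling_transform w))"
    using no_ternary_word by blast
qed

end
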